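(* Let $n,r$ be positive integers, let $\lambda=(\lambda_1,\dots,\lambda_r)$ be an $r$-tuple of partitions with $\sum_k|\lambda_k|=n$, and let $a_k=|\lambda_k|$. Suppose that any one of the following conditions holds: (1) there exist $i\ne j$ with $\big(\mathrm{bin}(a_i)\setminus\{\mathrm{ord}(a_i)\}\big)\cap\big(\mathrm{bin}(a_j)\setminus\{\mathrm{ord}(a_j)\}\big)\ne\emptyset$; (2) there exist three of the $a_k$ (three distinct indices) that are congruent to $2$ modulo $4$; (3) there exist three of the $a_k$ congruent to $3$, $2$, $1$ modulo $4$ respectively; (4) at least four of the $a_k$ are odd. Then $y_\lambda$ is even.
   Context: $\mathrm{bin}(m)$ is the set of powers of $2$ occurring in the binary expansion of $m$ (empty for $m=0$), and $\mathrm{ord}(m)$ is the highest power of $2$ dividing $m$ (for $m\geq 1$); so $\mathrm{bin}(m)\setminus\{\mathrm{ord}(m)\}$ removes the lowest binary digit $1$ (and it is empty for $m=0$). For a partition $\mu$ of $m$, $f_\mu$ and $\chi_\mu$ are the dimension and character of the irreducible complex representation of $S_m$ indexed by $\mu$; $g_\mu=\frac{f_\mu-\chi_\mu(s_1)}2$ with $s_1=(1\,2)$ if $m\ge2$, and $g_\mu=0$ if $m<2$. Put $\widehat f_{\lambda_k}=\prod_{j\ne k}f_{\lambda_j}$. Multinomial coefficients with a negative lower entry are $0$. For $n\ge2$ (each of the conditions forces $n\ge2$), $$y_\lambda=f_{\lambda_1}\cdots f_{\lambda_r}\frac{(n-2)!}{a_1!\cdots a_r!}\sum_{1\le i<j\le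 r}a_ia_j+\sum_{k=1}^r g_{\lambda_k}\widehat f_{\lambda_k}\binom{n-2}{a_1,\dots,a_k-2,\dots,a_r}.$$ *)

theory Defs
  imports
    Complex_Main
    "HOL-Combinatorics.Permutations"
    "HOL-Computational_Algebra.Primes"
    "HOL-Library.Function_Algebras"
begin

definition is_partition_of :: "nat list \<Rightarrow> nat \<Rightarrow> bool" where
  "is_partition_of \<mu> m \<longleftrightarrow>
     sorted_wrt (\<ge>) \<mu> \<and> (\<forall>p\<in>set \<mu>. p > 0) \<and> sum_list \<mu> = m"

text \<open>
  The complex vector space of functions on a set. Functions supported on the
  permutations of \<open>{1..m}\<close> form the group algebra of the symmetric group \<open>S\<^sub>m\<close>, where \<open>x\<close>
  stands for the formal sum of the \<open>x \<tau> \<cdot> \<tau>\<close>.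
\<close>

global_interpretation cfun: vector_space "\<lambda>(c::complex) (x::'a \<Rightarrow> complex) t. c * x t"
  defines cfun_span = cfun.span
    and cfun_dim = cfun.dim
    and cfun_independent = cfun.independent
    and cfun_representation = cfun.representation
  by unfold_locales (auto simp: fun_eq_iff algebra_simps)

text \<open>
  The canonical tableau of shape \<open>\<mu>\<close> is filled with \<open>1, 2, \<dots>, m\<close> row by row;
  rows and columns are indexed from 0.
\<close>

definition tab_entry :: "nat list \<Rightarrow> nat \<Rightarrow> nat \<Rightarrow> nat" where
  "tab_entry \<mu> i j = sum_list (take i \<mu>) + j + 1"

definition tab_row :: "nat list \<Rightarrow> nat \<Rightarrow> nat set" where
  "tab_row \<mu> i = {tab_entry \<mu> i j | j. i < length \<mu> \<and> j < \<mu> ! i}"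

definition tab_col :: "nat list \<Rightarrow> nat \<Rightarrow> nat set" where
  "tab_col \<mu> j = {tab_entry \<mu> i j | i. i < length \<mu> \<and> j < \<mu> ! i}"

definition row_group :: "nat list \<Rightarrow> (nat \<Rightarrow> nat) set" where
  "row_group \<mu> = {p. p permutes {1..sum_list \<mu>} \<and> (\<forall>i. p ` tab_row \<mu> i = tab_row \<mu> i)}"

definition col_group :: "nat list \<Rightarrow> (nat \<Rightarrow> nat) set" where
  "col_group \<mu> = {q. q permutes {1..sum_list \<mu>} \<and> (\<forall>j. q ` tab_col \<mu> j = tab_col \<mu> j)}"

text \<open>
  The Young symmetrizer: the sum of \<open>sign q \<cdot> (p \<circ> q)\<close> over \<open>p\<close> in the row group
  and \<open>q\<close> in the column group.
\<close>

definition young_symmetrizer :: "nat list \<Rightarrow> (nat \<Rightarrow> nat) \<Rightarrow> complex" where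
  "young_symmetrizer \<mu> =
     (\<lambda>\<tau>. \<Sum>p\<in>row_group \<mu>. \<Sum>q\<in>col_group \<mu>. if p \<circ> q = \<tau> then of_int (sign q) else 0)"

text \<open>Left multiplication by a permutation in the group algebra.\<close>

definition perm_act :: "(nat \<Rightarrow> nat) \<Rightarrow> ((nat \<Rightarrow> nat) \<Rightarrow> complex) \<Rightarrow> (nat \<Rightarrow> nat) \<Rightarrow> complex" where
  "perm_act \<sigma> x = (\<lambda>\<tau>. x (inv \<sigma> \<circ> \<tau>))"

text \<open>
  The irreducible module indexed by \<open>\<mu>\<close>: the left ideal generated by the Young
  symmetrizer. In this convention a one-row partition gives the trivial representation and a
  one-column partition gives the sign representation.
\<close>

definition irr_module :: "nat list \<Rightarrow> ((nat \<Rightarrow> nat) \<Rightarrow> complex) set" where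
  "irr_module \<mu> =
     cfun_span ((\<lambda>\<sigma>. perm_act \<sigma> (young_symmetrizer \<mu>)) ` {\<sigma>. \<sigma> permutes {1..sum_list \<mu>}})"

text \<open>
  The trace of \<open>T\<close> on a finite-dimensional \<open>T\<close>-invariant subspace \<open>V\<close>, computed in some
  basis of \<open>V\<close>.
\<close>

definition trace_on :: "('a \<Rightarrow> complex) set \<Rightarrow> (('a \<Rightarrow> complex) \<Rightarrow> ('a \<Rightarrow> complex)) \<Rightarrow> complex" where
  "trace_on V T =
     (let B = (SOME B. cfun_independent B \<and> cfun_span B = V)
      in \<Sum>b\<in>B. cfun_representation B (T b) b)"

definition irr_dim :: "nat list \<Rightarrow> nat" where
  "irr_dim \<mu> = cfun_dim (irr_module \<mu>)"

definition irr_char :: "nat list \<Rightarrow> (nat \<Rightarrow> nat) \<Rightarrow> complex" where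
  "irr_char \<mu> \<sigma> = trace_on (irr_module \<mu>) (perm_act \<sigma>)"

definition g_coeff :: "nat list \<Rightarrow> complex" where
  "g_coeff \<mu> =
     (if sum_list \<mu> \<ge> 2
      then (of_nat (irr_dim \<mu>) - irr_char \<mu> (transpose 1 2)) / 2 else 0)"

text \<open>
  Multinomial coefficient with upper entry \<open>N\<close> and lower entries \<open>e k\<close> for \<open>k \<in> I\<close>; the
  lower entries are meant to sum to \<open>N\<close>.
\<close>

definition multinom :: "nat \<Rightarrow> nat set \<Rightarrow> (nat \<Rightarrow> int) \<Rightarrow> complex" where
  "multinom N I e =
     (if \<exists>k\<in>I. e k < 0 then 0 else fact N / (\<Prod>k\<in>I. fact (nat (e k))))"

text \<open>
  The value \<open>y\<^sub>\<lambda>\<close> for the tuple \<open>lam 1, \<dots>, lam r\<close>. It is meant for total size \<open>n \<ge> 2\<close>; the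
  subtraction \<open>n - 2\<close> is truncated.
\<close>

definition y_val :: "nat \<Rightarrow> (nat \<Rightarrow> nat list) \<Rightarrow> complex" where
  "y_val r lam =
     (let a = (\<lambda>k. sum_list (lam k)); n = (\<Sum>k=1..r. a k)
      in (\<Prod>k=1..r. of_nat (irr_dim (lam k))) * (fact (n - 2) / (\<Prod>k=1..r. fact (a k)))
           * (\<Sum>(i, j)\<in>{(i, j). 1 \<le> i \<and> i < j \<and> j \<le> r}. of_nat (a i * a j))
         + (\<Sum>k=1..r. g_coeff (lam k) * (\<Prod>j\<in>{1..r} - {k}. of_nat (irr_dim (lam j)))
              * multinom (n - 2) {1..r} (\<lambda>l. if l = k then int (a l) - 2 else int (a l))))"

definition bin :: "nat \<Rightarrow> nat set" where
  "bin m = {2 ^ i | i. bit m i}"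

text \<open>The highest power of 2 dividing \<open>m\<close>, itself a power of 2 (the value at 0 is irrelevant).\<close>

definition ord2 :: "nat \<Rightarrow> nat" where
  "ord2 m = 2 ^ multiplicity 2 m"

end

theory Submission
  imports Defs
begin

text \<open>
  Up to factors that are natural numbers, every summand of \<open>y\<^sub>\<lambda>\<close> is a multinomial coefficient
  with upper entry \<open>n - 2\<close>, whose lower entries arise from the \<open>a\<^sub>k\<close> either by lowering two of them
  by 1 or by lowering one of them by 2. A multinomial coefficient is even as soon as two of
  its lower entries have a common binary digit, and each of the four conditions forces this for
  all the coefficients that occur. The only fact needed about the representations is that
  \<open>g\<^sub>\<mu>\<close> is a natural number: it is the dimension of the \<open>-1\<close>-eigenspace of \<open>s\<^sub>1\<close>.
\<close>

subsection \<open>Traces of involutions\<close>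

abbreviation (input) cscale :: "complex \<Rightarrow> ('a \<Rightarrow> complex) \<Rightarrow> 'a \<Rightarrow> complex" where
  "cscale \<equiv> \<lambda>c x t. c * x t"

text \<open>Expanding \<open>T b\<close> over \<open>C\<close> and then \<open>T c\<close> over
  \<open>B\<close> turns both traces into the same double sum of products of coordinates, up to the
  order of summation.\<close>

lemma trace_basis_independent:
  assumes lin: "Vector_Spaces.linear cscale cscale T"
    and B: "cfun.independent B" "finite B" and C: "cfun.independent C" "finite C"
    and BC: "cfun_span B = cfun_span C" and inv: "\<And>v. v \<in> cfun_span C \<Longrightarrow> T v \<in> cfun_span C"
  shows "(\<Sum>b\<in>B. cfun_representation B (T b) b) = (\<Sum>c\<in>C. cfun_representation C (T c) c)"
proof -
  interpret T: Vector_Spaces.linear cscale cscale T by (rule lin)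
  let ?rB = "cfun_representation B" and ?rC = "cfun_representation C"
  have inB: "T c \<in> cfun_span B" "c \<in> cfun_span B" if "c \<in> C" for c
    using that inv BC by (auto intro: cfun.span_base)
  have inC: "b \<in> cfun_span C" if "b \<in> B" for b
    using that BC cfun.span_base by blast
  have "(\<Sum>b\<in>B. ?rB (T b) b) = (\<Sum>b\<in>B. \<Sum>c\<in>C. ?rC b c * ?rB (T c) b)"
  proof (rule sum.cong[OF refl])
    fix b assume b: "b \<in> B"
    have "T b = T (\<Sum>c\<in>C. cscale (?rC b c) c)"
      using cfun.sum_representation_eq[OF C(1) inC[OF b] C(2) order_refl] by simp
    also have "\<dots> = (\<Sum>c\<in>C. cscale (?rC b c) (T c))"
      by (simp only: T.sum T.scale)
    finally have *: "T b = (\<Sum>c\<in>C. cscale (?rC b c) (T c))" .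
    show "?rB (T b) b = (\<Sum>c\<in>C. ?rC b c * ?rB (T c) b)"
      unfolding * by (subst cfun.representation_sum)
        (simp_all add: B inB cfun.span_scale cfun.representation_scale)
  qed
  also have "\<dots> = (\<Sum>c\<in>C. \<Sum>b\<in>B. ?rB (T c) b * ?rC b c)"
    by (subst sum.swap) (simp add: mult.commute)
  also have "\<dots> = (\<Sum>c\<in>C. ?rC (T c) c)"
  proof (rule sum.cong[OF refl])
    fix c assume c: "c \<in> C"
    have "?rC (T c) c = ?rC (\<Sum>b\<in>B. cscale (?rB (T c) b) b) c"
      using cfun.sum_representation_eq[OF B(1) inB(1)[OF c] B(2) order_refl] by simp
    also have "\<dots> = (\<Sum>b\<in>B. ?rB (T c) b * ?rC b c)"
      by (subst cfun.representation_sum)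
        (simp_all add: C inC cfun.span_scale cfun.representation_scale)
    finally show "(\<Sum>b\<in>B. ?rB (T c) b * ?rC b c) = ?rC (T c) c" by simp
  qed
  finally show ?thesis .
qed

text \<open>Frees the trace from the basis picked by \<open>SOME\<close>, so that it can be computed
  in a basis adapted to \<open>T\<close>.\<close>

lemma trace_on_eq:
  assumes "Vector_Spaces.linear cscale cscale T" "cfun.independent C" "finite C"
    and "\<And>v. v \<in> cfun_span C \<Longrightarrow> T v \<in> cfun_span C"
  shows "trace_on (cfun_span C) T = (\<Sum>c\<in>C. cfun_representation C (T c) c)"
proof -
  define B where "B = (SOME B. cfun_independent B \<and> cfun_span B = cfun_span C)"
  have B: "cfun.independent B" "cfun_span B = cfun_span C"
    using someI[of "\<lambda>B. cfun_independent B \<and> cfun_span B = cfun_span C" C] assms(2)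
    by (auto simp: B_def cfun_independent_def)
  \<comment> \<open>The chosen basis is not finite by definition; it is finite because it is
    independent and lies in the span of the finite set \<open>C\<close>.\<close>
  moreover have "finite B"
    using cfun.independent_span_bound[of C B] B assms(3) cfun.span_superset[of B] by blast
  ultimately show ?thesis
    using trace_basis_independent[of T B C] assms
    by (simp add: trace_on_def Let_def B_def[symmetric])
qed

text \<open>The \<open>\<plusminus>1\<close>-eigenvectors of an involution span, so a basis can be chosen among them; the
  witness is the dimension of the \<open>-1\<close>-eigenspace.\<close>

lemma involution_dim_minus_trace:
  assumes lin: "Vector_Spaces.linear cscale cscale T" and S: "finite S"
    and inv: "\<And>v. v \<in> cfun_span S \<Longrightarrow> T v \<in> cfun_span S"
    and TT: "\<And>v. v \<in> cfun_span S \<Longrightarrow> T (T v) = v"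
  obtains k :: nat where "of_nat (cfun_dim (cfun_span S)) - trace_on (cfun_span S) T = 2 * of_nat k"
proof -
  interpret T: Vector_Spaces.linear cscale cscale T by (rule lin)
  define E where "E = {v \<in> cfun_span S. T v = v \<or> T v = - v}"
  have ES: "cfun_span E = cfun_span S"
  proof
    have "E \<subseteq> cfun_span S" by (auto simp: E_def)
    then show "cfun_span E \<subseteq> cfun_span S"
      using cfun.span_minimal cfun.subspace_span by blast
    show "cfun_span S \<subseteq> cfun_span E"
    proof
      fix v assume v: "v \<in> cfun_span S"
      \<comment> \<open>The components of \<open>v\<close> in the eigenspaces for 1 and -1.\<close>
      define p where "p = cscale (1/2) (v + T v)"
      define m where "m = cscale (1/2) (v - T v)"
      have "T p = p"
        unfolding p_def T.scale T.add TT[OF v] by (simp add: add.commute)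
      moreover have "p \<in> cfun_span S"
        unfolding p_def by (intro cfun.span_scale cfun.span_add v inv)
      ultimately have "p \<in> E" by (simp add: E_def)
      have "T m = - m"
        unfolding m_def T.scale T.diff TT[OF v] by (simp add: fun_eq_iff field_simps)
      moreover have "m \<in> cfun_span S"
        unfolding m_def by (intro cfun.span_scale cfun.span_diff v inv)
      ultimately have "m \<in> E" by (simp add: E_def)
      have "v = p + m"
        by (auto simp: p_def m_def fun_eq_iff field_simps)
      then show "v \<in> cfun_span E"
        using \<open>p \<in> E\<close> \<open>m \<in> E\<close> by (metis cfun.span_add cfun.span_base)
    qed
  qed
  obtain C where C: "C \<subseteq> E" "cfun.independent C" "E \<subseteq> cfun_span C"
    using cfun.maximal_independent_subset[of E] by blast
  have CS: "cfun_span C = cfun_span S"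
    using C(1,3) ES by (metis cfun.span_mono cfun.span_minimal cfun.subspace_span subset_antisym)
  have fC: "finite C"
    using cfun.independent_span_bound[OF S C(2)] CS cfun.span_superset[of C] by blast
  have "trace_on (cfun_span S) T = (\<Sum>c\<in>C. cfun_representation C (T c) c)"
    using trace_on_eq[OF lin C(2) fC] inv CS by metis
  \<comment> \<open>In a basis of eigenvectors the matrix of \<open>T\<close> is diagonal with
    entries 1 and -1, so the trace falls short of the dimension by 2 for each entry -1.\<close>
  also have "\<dots> = (\<Sum>c\<in>C. 1 - 2 * of_bool (T c \<noteq> c))"
  proof (rule sum.cong[OF refl])
    fix c assume c: "c \<in> C"
    then have "T c = c \<or> T c = - c" using C(1) E_def by blast
    then show "cfun_representation C (T c) c = 1 - 2 * of_bool (T c \<noteq> c)"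
      using c C(2) cfun.span_base[OF c]
      by (auto simp: cfun.representation_basis cfun.representation_neg)
  qed
  also have "\<dots> = of_nat (card C) - 2 * of_nat (card {c \<in> C. T c \<noteq> c})"
    using fC by (simp add: sum_subtractf sum_distrib_left[symmetric] Int_def)
  finally have "trace_on (cfun_span S) T = of_nat (card C) - 2 * of_nat (card {c \<in> C. T c \<noteq> c})" .
  moreover have "cfun_dim (cfun_span S) = card C"
    using cfun.dim_eq_card[OF CS C(2)] cfun.dim_span by simp
  ultimately show ?thesis by (intro that[of "card {c \<in> C. T c \<noteq> c}"]) simp
qed

section \<open>The group action on the irreducible modules and integrality of
  \<open>g_coeff\<close>\<close>

lemma perm_act_linear: "Vector_Spaces.linear cscale cscale (perm_act \<sigma>)"
  by unfold_locales (auto simp: perm_act_def fun_eq_iff algebra_simps)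

lemma perm_act_perm_act:
  assumes "\<sigma> permutes A" "\<rho> permutes A"
  shows "perm_act \<sigma> (perm_act \<rho> x) = perm_act (\<sigma> \<circ> \<rho>) x"
  using assms by (simp add: perm_act_def permutes_inv_o o_inv_distrib permutes_bij o_assoc)

text \<open>Left multiplication permutes the generators of the module, and the preimage of a
  subspace under a linear map is a subspace, so it contains the whole span.\<close>

lemma perm_act_irr_module:
  assumes \<sigma>: "\<sigma> permutes {1..sum_list \<mu>}" and v: "v \<in> irr_module \<mu>"
  shows "perm_act \<sigma> v \<in> irr_module \<mu>"
proof -
  interpret T: Vector_Spaces.linear cscale cscale "perm_act \<sigma>" by (rule perm_act_linear)
  let ?G = "(\<lambda>\<sigma>. perm_act \<sigma> (young_symmetrizer \<mu>)) ` {\<sigma>. \<sigma> permutes {1..sum_list \<mu>}}"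
  have "perm_act \<sigma> w \<in> cfun_span ?G" if "w \<in> ?G" for w
  proof -
    obtain \<rho> where \<rho>: "\<rho> permutes {1..sum_list \<mu>}" "w = perm_act \<rho> (young_symmetrizer \<mu>)"
      using \<open>w \<in> ?G\<close> by blast
    have "\<sigma> \<circ> \<rho> permutes {1..sum_list \<mu>}" by (rule permutes_compose[OF \<rho>(1) \<sigma>])
    then show ?thesis
      unfolding \<rho>(2) perm_act_perm_act[OF \<sigma> \<rho>(1)] by (intro cfun.span_base imageI CollectI)
  qed
  then have "?G \<subseteq> {w. perm_act \<sigma> w \<in> cfun_span ?G}" by blast
  moreover have "cfun.subspace {w. perm_act \<sigma> w \<in> cfun_span ?G}"
    by (rule cfun.subspaceI)
      (simp_all only: mem_Collect_eq T.zero T.add T.scale cfun.span_zero cfun.span_add cfun.span_scale)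
  ultimately have "cfun_span ?G \<subseteq> {w. perm_act \<sigma> w \<in> cfun_span ?G}"
    by (rule cfun.span_minimal)
  then show ?thesis using v unfolding irr_module_def by blast
qed

text \<open>The transposition acts on the module as an involution, so dimension minus character is
  twice a natural number, and the denominator 2 cancels. Below size 2 the value is 0 by
  definition.\<close>

lemma g_coeff_in_Nats: "g_coeff \<mu> \<in> \<nat>"
proof (cases "sum_list \<mu> \<ge> 2")
  case True
  define s where "s = transpose (1::nat) 2"
  have s: "s permutes {1..sum_list \<mu>}"
    using True by (auto simp: s_def intro: permutes_swap_id)
  have "perm_act s (perm_act s v) = v" for v
    by (simp add: perm_act_perm_act[OF s s]) (simp add: s_def perm_act_def)
  then obtain k :: nat where "of_nat (irr_dim \<mu>) - irr_char \<mu> s = 2 * of_nat k"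
    using involution_dim_minus_trace[OF perm_act_linear[of s],
        of "(\<lambda>\<sigma>. perm_act \<sigma> (young_symmetrizer \<mu>)) ` {\<sigma>. \<sigma> permutes {1..sum_list \<mu>}}"]
      perm_act_irr_module[OF s] finite_permutations[of "{1..sum_list \<mu>}"]
    unfolding irr_module_def irr_dim_def irr_char_def by blast
  then show ?thesis using True by (simp add: g_coeff_def s_def)
qed (simp add: g_coeff_def)

subsection \<open>Parity of multinomial coefficients\<close>

text \<open>The even factors 2, 4, ..., 2m of (2m)! contribute \<open>2 ^ m * fact m\<close>; the
  odd factors make up \<open>q\<close>.\<close>

lemma fact_double_odd_part: "\<exists>q::nat. odd q \<and> fact (2 * m) = 2 ^ m * fact m * q"
proof (induction m)
  case (Suc m)
  then obtain q :: nat where q: "odd q" "fact (2 * m) = 2 ^ m * fact m * q" by blast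
  have "fact (2 * Suc m) = (2 * m + 2) * ((2 * m + 1) * fact (2 * m) :: nat)" by simp
  also have "\<dots> = 2 ^ Suc m * fact (Suc m) * (q * (2 * m + 1))"
    unfolding q(2) by (simp add: algebra_simps)
  finally show ?case using q(1) by (intro exI[of _ "q * (2 * m + 1)"]) simp
qed (simp add: exI[of _ 1])

lemma fact_odd_part: "\<exists>q::nat. odd q \<and> fact n = 2 ^ (n div 2) * fact (n div 2) * q"
proof (cases "even n")
  case True
  then show ?thesis using fact_double_odd_part[of "n div 2"] by simp
next
  case False
  then obtain m where m: "n = 2 * m + 1" by (elim oddE)
  obtain q :: nat where q: "odd q" "fact (2 * m) = 2 ^ m * fact m * q"
    using fact_double_odd_part by blast
  have "fact n = (2 * m + 1) * (fact (2 * m) :: nat)" by (simp add: m)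
  then have "fact n = 2 ^ (n div 2) * fact (n div 2) * (q * (2 * m + 1))"
    unfolding q(2) m by (simp add: algebra_simps)
  then show ?thesis using q(1) by (intro exI[of _ "q * (2 * m + 1)"]) simp
qed

text \<open>By absorption, \<open>x\<close> times the coefficient is a multiple of the even number
  \<open>x + y\<close>, while \<open>x\<close> is odd.\<close>

lemma even_binomial_odd_odd:
  assumes "odd x" "odd y"
  shows "even ((x + y) choose x)"
proof -
  obtain x' where x': "x = Suc x'" using assms(1) by (cases x) auto
  have "x * ((x + y) choose x) = (x + y) * ((x' + y) choose x')"
    using Suc_times_binomial_eq[of "x' + y" x'] by (simp add: x')
  moreover have "even (x + y)" using assms by simp
  ultimately show ?thesis using assms(1) by (metis even_mult_iff)
qed

text \<open>With at most one odd argument the lowest digits add without a carry, so the halves add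
  up to the half of the sum. The powers of 2 split off the three factorials then cancel, leaving odd
  factors only.\<close>

lemma even_binomial_halve:
  assumes "even x \<or> even y"
  shows "even ((x + y) choose x) \<longleftrightarrow> even ((x div 2 + y div 2) choose (x div 2))"
proof -
  have half: "(x + y) div 2 = x div 2 + y div 2" using assms by (auto elim!: evenE)
  obtain p q s :: nat where
    p: "odd p" "fact x = 2 ^ (x div 2) * fact (x div 2) * p" and
    q: "odd q" "fact y = 2 ^ (y div 2) * fact (y div 2) * q" and
    s: "odd s" "fact (x + y) = 2 ^ ((x + y) div 2) * fact ((x + y) div 2) * s"
    using fact_odd_part by metis
  let ?u = "x div 2" and ?v = "y div 2"
  let ?K = "2 ^ (?u + ?v) * fact ?u * fact ?v :: nat"
  have "?K * (p * q * ((x + y) choose x)) = fact x * fact y * ((x + y) choose x)"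
    unfolding p(2) q(2) by (simp only: power_add mult_ac)
  also have "\<dots> = fact (x + y)"
    using binomial_fact_lemma[of x "x + y"] by simp
  also have "\<dots> = 2 ^ (?u + ?v) * fact (?u + ?v) * s"
    unfolding s(2) half ..
  also have "fact (?u + ?v) = fact ?u * fact ?v * ((?u + ?v) choose ?u)"
    using binomial_fact_lemma[of ?u "?u + ?v"] by simp
  finally have "?K * (p * q * ((x + y) choose x)) = ?K * (s * ((?u + ?v) choose ?u))"
    by (simp only: mult_ac)
  then have "p * q * ((x + y) choose x) = s * ((?u + ?v) choose ?u)"
    by simp
  then show ?thesis using p(1) q(1) s(1) by (metis even_mult_iff)
qed

text \<open>One direction of Kummer's theorem at the prime 2: halving moves the common digit down to
  position 0, unless both numbers are odd at an earlier stage, where evenness is immediate.\<close>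

lemma even_binomial_common_bit:
  fixes x y :: nat
  assumes "bit x t" "bit y t"
  shows "even ((x + y) choose x)"
  using assms
proof (induction t arbitrary: x y)
  case 0
  then show ?case using even_binomial_odd_odd by (simp add: bit_0)
next
  case (Suc t)
  then show ?case
    using even_binomial_odd_odd even_binomial_halve[of x y] by (auto simp: bit_Suc)
qed

section \<open>From binomial to multinomial coefficients\<close>

lemma prod_fact_dvd_fact_sum:
  "finite I \<Longrightarrow> (\<Prod>k\<in>I. fact (e k)) dvd (fact (\<Sum>k\<in>I. e k) :: nat)"
proof (induction I rule: finite_induct)
  case (insert i I)
  then have "fact (e i) * (\<Prod>k\<in>I. fact (e k)) dvd (fact (e i) * fact (\<Sum>k\<in>I. e k) :: nat)"
    by simp
  also have "\<dots> dvd fact (e i + (\<Sum>k\<in>I. e k))" by (rule fact_fact_dvd_fact)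
  finally show ?case using insert by simp
qed simp

definition share_bit :: "'i set \<Rightarrow> ('i \<Rightarrow> nat) \<Rightarrow> bool" where
  "share_bit I e \<longleftrightarrow> (\<exists>i\<in>I. \<exists>j\<in>I. i \<noteq> j \<and> (\<exists>t. bit (e i) t \<and> bit (e j) t))"

text \<open>The multinomial coefficient factors through the binomial coefficient of the two entries
  with a common digit, which is even; the remaining factors are integers.\<close>

lemma multinomial_even:
  assumes "finite I" "share_bit I e"
  shows "2 * (\<Prod>k\<in>I. fact (e k)) dvd (fact (\<Sum>k\<in>I. e k) :: nat)"
proof -
  obtain i j t where ij: "i \<in> I" "j \<in> I" "i \<noteq> j" "bit (e i) t" "bit (e j) t"
    using assms(2) by (auto simp: share_bit_def)
  define J where "J = I - {i, j}"
  have I: "I = insert i (insert j J)" "finite J" "i \<notin> insert j J" "j \<notin> J"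
    using ij assms(1) by (auto simp: J_def)
  have "2 * (fact (e i) * fact (e j)) dvd (fact (e i + e j) :: nat)"
    using binomial_fact_lemma[of "e i" "e i + e j"] even_binomial_common_bit[OF ij(4,5)]
    by (metis add_diff_cancel_left' le_add1 mult.commute mult_dvd_mono dvd_refl)
  then have "2 * (fact (e i) * fact (e j)) * (\<Prod>k\<in>J. fact (e k))
      dvd (fact (e i + e j) * fact (\<Sum>k\<in>J. e k) :: nat)"
    using prod_fact_dvd_fact_sum[OF I(2)] by (rule mult_dvd_mono)
  also have "\<dots> dvd fact (e i + e j + (\<Sum>k\<in>J. e k))" by (rule fact_fact_dvd_fact)
  finally show ?thesis using I by (simp add: add.assoc mult.assoc)
qed

lemma share_bitI:
  assumes "i \<in> I" "j \<in> I" "i \<noteq> j" "bit (e i) t" "bit (e j) t"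
  shows "share_bit I e"
  using assms by (auto simp: share_bit_def)

lemma share_bit_oddI:
  assumes "i \<in> I" "j \<in> I" "i \<noteq> j" "odd (e i)" "odd (e j)"
  shows "share_bit I e"
  using assms by (auto intro: share_bitI[where t = 0] simp: bit_0)

lemma bit_1_iff_mod_4: "bit (m :: nat) 1 \<longleftrightarrow> m mod 4 \<in> {2, 3}"
proof -
  have "bit m 1 \<longleftrightarrow> odd (m div 2)" by (simp add: bit_iff_odd)
  also have "\<dots> \<longleftrightarrow> m mod 4 \<in> {2, 3}" by (simp, presburger)
  finally show ?thesis .
qed

lemma share_bit_mod_4I:
  assumes "i \<in> I" "j \<in> I" "i \<noteq> j" "e i mod 4 \<in> {2, 3}" "e j mod 4 \<in> {2, 3}"
  shows "share_bit I e"
  using assms bit_1_iff_mod_4 by (intro share_bitI[where t = 1 and i = i and j = j]) auto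

subsection \<open>Common binary digits of the lowered sizes\<close>

text \<open>The nonzero remainder says that some digit 1 lies below position \<open>t\<close>, so
  \<open>t\<close> is the position of an element of \<open>bin m\<close> other than the
  lowest.\<close>

definition upper_bit :: "nat \<Rightarrow> nat \<Rightarrow> bool" where
  "upper_bit m t \<longleftrightarrow> bit m t \<and> m mod 2 ^ t \<noteq> 0"

text \<open>A digit 1 at \<open>t\<close> with only zeros below it makes \<open>2 ^ t\<close> the
  exact power of 2 dividing \<open>m\<close>, that is \<open>ord2 m\<close>.\<close>

lemma upper_bitI:
  assumes "2 ^ t \<in> bin m" "2 ^ t \<noteq> ord2 m"
  shows "upper_bit m t"
proof -
  have b: "bit m t" using assms(1) by (auto simp: bin_def)
  have "m mod 2 ^ t \<noteq> 0"
  proof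
    assume "m mod 2 ^ t = 0"
    then have m: "m = 2 ^ t * (m div 2 ^ t)" by (simp add: mod_eq_0_iff_dvd)
    have "odd (m div 2 ^ t)" using b by (simp add: bit_iff_odd)
    moreover have "even (m div 2 ^ t)" if "2 ^ Suc t dvd m"
      using that by (auto elim!: dvdE)
    moreover have "2 ^ t dvd m" using m by (metis dvd_triv_left)
    ultimately have "multiplicity 2 m = t" by (intro multiplicity_eqI) blast+
    then show False using assms(2) by (simp add: ord2_def)
  qed
  then show ?thesis using b by (simp add: upper_bit_def)
qed

text \<open>The nonzero part of \<open>m\<close> below position \<open>t\<close> absorbs the
  subtraction, so no borrow reaches \<open>t\<close>.\<close>

lemma upper_bit_diff_1: "upper_bit m t \<Longrightarrow> bit (m - 1) t"
proof -
  assume u: "upper_bit m t"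
  define q s where "q = m div 2 ^ t" and "s = m mod 2 ^ t"
  have m: "m = 2 ^ t * q + s" by (simp add: q_def s_def)
  have s: "0 < s" "s < 2 ^ t" and q: "odd q"
    using u by (auto simp: upper_bit_def bit_iff_odd q_def s_def)
  have "m - 1 = 2 ^ t * q + (s - 1)" using m s by simp
  then have "(m - 1) div 2 ^ t = q + (s - 1) div 2 ^ t"
    using div_mult_self4[of "2 ^ t" q "s - 1"] by (simp only: power_not_zero zero_neq_numeral[symmetric] not_False_eq_True)
  then have "(m - 1) div 2 ^ t = q" using s by simp
  then show ?thesis using q by (simp add: bit_iff_odd)
qed

lemma upper_bit_imp_bit: "upper_bit m t \<Longrightarrow> bit m t"
  by (simp add: upper_bit_def)

text \<open>If \<open>m - 2\<close> loses the bit \<open>t\<close>, the borrow has turned all lower bits into ones, and one of them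
  is the lowest bit of \<open>m'\<close>.\<close>

lemma upper_bit_diff_2:
  assumes "upper_bit m t" "upper_bit m' t"
  shows "\<exists>t'. bit (m - 2) t' \<and> bit m' t'"
proof -
  define q s where "q = m div 2 ^ t" and "s = m mod 2 ^ t"
  have m: "m = 2 ^ t * q + s" by (simp add: q_def s_def)
  have s: "0 < s" "s < 2 ^ t" and q: "odd q"
    using assms(1) by (auto simp: upper_bit_def bit_iff_odd q_def s_def)
  show ?thesis
  proof (cases "s \<ge> 2")
    case True
    then have "m - 2 = 2 ^ t * q + (s - 2)" using m by simp
    then have "(m - 2) div 2 ^ t = q" using s by simp
    then have "bit (m - 2) t" using q by (simp add: bit_iff_odd)
    then show ?thesis using assms(2) upper_bit_imp_bit by blast
  next
    case False
    obtain q' where q': "q = Suc q'" using q by (cases q) auto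
    \<comment> \<open>Here \<open>s = 1\<close>, so subtracting 2 borrows one unit from
      \<open>q\<close> and leaves \<open>2 ^ t - 1\<close> below position \<open>t\<close>.\<close>
    have "m - 2 = 2 ^ t * q' + (2 ^ t - 1)" using m s False q' by simp
    then have "(m - 2) mod 2 ^ t = (2 ^ t - 1) mod 2 ^ t" by (simp only: mod_mult_self4)
    then have "(m - 2) mod 2 ^ t = 2 ^ t - 1" by simp
    then have low: "take_bit t (m - 2) = mask t" by (simp add: take_bit_eq_mod mask_eq_exp_minus_1)
    have "take_bit t m' \<noteq> 0" using assms(2) by (simp add: upper_bit_def take_bit_eq_mod)
    then obtain t' where "bit (take_bit t m') t'" by (metis bit_eqI bit_0_eq bot_apply bot_bool_def)
    then have t': "t' < t" "bit m' t'" by (auto simp: bit_take_bit_iff)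
    have "bit (take_bit t (m - 2)) t'" unfolding low using t' by (simp add: bit_mask_iff)
    then show ?thesis using t' by (auto simp: bit_take_bit_iff)
  qed
qed

section \<open>Each of the four conditions yields a common digit\<close>

definition size_cond :: "'i set \<Rightarrow> ('i \<Rightarrow> nat) \<Rightarrow> bool" where
  "size_cond I a \<longleftrightarrow>
    (\<exists>i\<in>I. \<exists>j\<in>I. i \<noteq> j \<and> (bin (a i) - {ord2 (a i)}) \<inter> (bin (a j) - {ord2 (a j)}) \<noteq> {})
    \<or> (\<exists>i\<in>I. \<exists>j\<in>I. \<exists>k\<in>I. i \<noteq> j \<and> i \<noteq> k \<and> j \<noteq> k \<and>
         a i mod 4 = 2 \<and> a j mod 4 = 2 \<and> a k mod 4 = 2)
    \<or> (\<exists>i\<in>I. \<exists>j\<in>I. \<exists>k\<in>I. a i mod 4 = 3 \<and> a j mod 4 = 2 \<and> a k mod 4 = 1)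
    \<or> card {k \<in> I. odd (a k)} \<ge> 4"

lemma mod_4_diff_1:
  fixes m :: nat
  assumes "m mod 4 = Suc c"
  shows "(m - 1) mod 4 = c"
proof -
  have "m - 1 = c + 4 * (m div 4)" using assms mult_div_mod_eq[of 4 m] by linarith
  then have "(m - 1) mod 4 = c mod 4" by (simp only: mod_mult_self2)
  moreover have "Suc c < 4" unfolding assms[symmetric] by simp
  ultimately show ?thesis by simp
qed

lemma mod_4_parity:
  fixes m :: nat
  shows "m mod 4 = 3 \<Longrightarrow> odd m" "m mod 4 = 1 \<Longrightarrow> odd m" "m mod 4 = 2 \<Longrightarrow> odd (m - 1)"
    "m mod 4 = 2 \<Longrightarrow> even m"
  using even_even_mod_4_iff[of m] even_even_mod_4_iff[of "m - 1"] mod_4_diff_1[of m 1] by auto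

lemma size_cond_cases [consumes 1, case_names upper two three four]:
  assumes "size_cond I a"
  obtains i j t where "i \<in> I" "j \<in> I" "i \<noteq> j" "upper_bit (a i) t" "upper_bit (a j) t"
    | i j k where "i \<in> I" "j \<in> I" "k \<in> I" "i \<noteq> j" "i \<noteq> k" "j \<noteq> k"
        "a i mod 4 = 2" "a j mod 4 = 2" "a k mod 4 = 2"
    | i j k where "i \<in> I" "j \<in> I" "k \<in> I" "i \<noteq> j" "i \<noteq> k" "j \<noteq> k"
        "a i mod 4 = 3" "a j mod 4 = 2" "a k mod 4 = 1"
    | "card {k \<in> I. odd (a k)} \<ge> 4"
proof -
  have *: "\<exists>t. upper_bit x t \<and> upper_bit y t"
    if "(bin x - {ord2 x}) \<inter> (bin y - {ord2 y}) \<noteq> {}" for x y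
  proof -
    obtain z where z: "z \<in> (bin x - {ord2 x}) \<inter> (bin y - {ord2 y})"
      using \<open>_ \<noteq> {}\<close> by blast
    moreover obtain t where "z = 2 ^ t" using z by (auto simp: bin_def)
    ultimately show ?thesis using upper_bitI by blast
  qed
  show thesis
    using assms[unfolded size_cond_def]
  proof (elim disjE)
    assume "\<exists>i\<in>I. \<exists>j\<in>I. i \<noteq> j \<and> (bin (a i) - {ord2 (a i)}) \<inter> (bin (a j) - {ord2 (a j)}) \<noteq> {}"
    then show thesis using * that(1) by meson
  next
    assume "\<exists>i\<in>I. \<exists>j\<in>I. \<exists>k\<in>I. a i mod 4 = 3 \<and> a j mod 4 = 2 \<and> a k mod 4 = 1"
    then obtain i j k where "i \<in> I" "j \<in> I" "k \<in> I" "a i mod 4 = 3" "a j mod 4 = 2" "a k mod 4 = 1"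
      by blast
    \<comment> \<open>The three residues differ, hence so do the indices.\<close>
    then show thesis using that(3)[of i j k] by force
  qed (use that in blast)+
qed

text \<open>Supplies odd sizes away from the lowered entries; \<open>k = l\<close> is allowed, for
  the case of a single entry lowered by 2.\<close>

lemma two_more_odd:
  assumes "card {k \<in> I. odd (a k)} \<ge> 4"
  obtains i j where "i \<in> I - {k, l}" "j \<in> I - {k, l}" "i \<noteq> j" "odd (a i)" "odd (a j)"
proof -
  let ?S = "{k \<in> I. odd (a k)} - {k, l}"
  have "card {k, l} \<le> 2" by (simp add: card_insert_if)
  then have "card ?S \<ge> 2"
    using assms diff_card_le_card_Diff[of "{k, l}" "{k \<in> I. odd (a k)}"] by simp
  then obtain T where "T \<subseteq> ?S" "card T = 2" by (meson obtain_subset_with_card_n)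
  then show thesis by (auto simp: card_2_iff intro: that)
qed

text \<open>Lowering by 2 keeps parity, so the odd sizes 3 and 1 modulo 4 still share digit 0. Of
  three sizes congruent to 2 modulo 4 two are untouched and share digit 1. Four odd sizes leave two
  untouched. Only a common upper digit may have to be replaced by another one.\<close>

lemma share_bit_diff_2:
  assumes "size_cond I a" "a k \<ge> 2"
  shows "share_bit I (a(k := a k - 2))"
  using assms(1)
proof (cases rule: size_cond_cases)
  case (upper i j t)
  have b: "bit (a i) t" "bit (a j) t" using upper upper_bit_imp_bit by auto
  obtain t1 t2 where "bit (a i - 2) t1" "bit (a j) t1" "bit (a j - 2) t2" "bit (a i) t2"
    using upper upper_bit_diff_2 by metis
  \<comment> \<open>The position is \<open>t1\<close> if \<open>k = i\<close>, \<open>t2\<close> if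
    \<open>k = j\<close>, and \<open>t\<close> otherwise.\<close>
  then obtain t' where "bit ((a(k := a k - 2)) i) t'" "bit ((a(k := a k - 2)) j) t'"
    using b \<open>i \<noteq> j\<close> by (cases "k = i"; cases "k = j") (metis fun_upd_same fun_upd_other)+
  then show ?thesis using upper share_bitI by metis
next
  case (two i j l)
  then obtain x y where "x \<in> I - {k}" "y \<in> I - {k}" "x \<noteq> y" "a x mod 4 = 2" "a y mod 4 = 2"
    by (metis Diff_iff singletonD)
  then show ?thesis using share_bit_mod_4I[of x I y "a(k := a k - 2)"] by auto
next
  case (three i j l)
  have "odd ((a(k := a k - 2)) x)" if "odd (a x)" for x using that assms(2) by auto
  then show ?thesis
    using mod_4_parity(1)[OF three(7)] mod_4_parity(2)[OF three(9)] three share_bit_oddI by metis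
next
  case four
  then obtain i j where "i \<in> I - {k, k}" "j \<in> I - {k, k}" "i \<noteq> j" "odd (a i)" "odd (a j)"
    by (rule two_more_odd)
  then show ?thesis using share_bit_oddI[of i I j "a(k := a k - 2)"] by auto
qed

text \<open>Upper digits survive lowering by 1; the other conditions are settled by which of the
  named indices are lowered.\<close>

lemma share_bit_diff_1_1:
  assumes "size_cond I a" "k \<noteq> l" "a k > 0" "a l > 0"
  shows "share_bit I (a(k := a k - 1, l := a l - 1))" (is "share_bit I ?e")
  using assms(1)
proof (cases rule: size_cond_cases)
  case (upper i j t)
  then have "bit (?e i) t" "bit (?e j) t"
    using upper_bit_imp_bit upper_bit_diff_1 by auto
  then show ?thesis using upper share_bitI by metis
next
  case (two i j m)
  \<comment> \<open>A size congruent to 2 modulo 4 keeps digit 1 if untouched and becomes odd if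
    lowered. Two of the three indices fall into the same class and share that digit.\<close>
  have e: "?e x mod 4 = 2 \<and> x \<notin> {k, l} \<or> odd (?e x) \<and> x \<in> {k, l}" if "a x mod 4 = 2" for x
    using that by (auto simp: mod_4_parity mod_4_diff_1[of _ 2, simplified])
  show ?thesis
    using e[OF two(7)] e[OF two(8)] e[OF two(9)] two(1-6)
      share_bit_mod_4I[of i I j ?e] share_bit_mod_4I[of i I m ?e] share_bit_mod_4I[of j I m ?e]
      share_bit_oddI[of i I j ?e] share_bit_oddI[of i I m ?e] share_bit_oddI[of j I m ?e]
    by blast
next
  case (three i j m)
  \<comment> \<open>Entry \<open>i\<close> keeps digit 1 in either case and shares it with
    \<open>j\<close> if \<open>j\<close> is untouched. If \<open>j\<close> is lowered it becomes
    odd, and at least one of \<open>i\<close> and \<open>m\<close> is untouched and odd.\<close>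
  have i: "?e i mod 4 = 2 \<and> i \<in> {k, l} \<or> ?e i mod 4 = 3 \<and> odd (?e i) \<and> i \<notin> {k, l}"
    using three(7) by (auto simp: mod_4_parity mod_4_diff_1[of _ 2, simplified])
  have j: "odd (?e j) \<and> j \<in> {k, l} \<or> ?e j mod 4 = 2 \<and> j \<notin> {k, l}"
    using three(8) by (auto simp: mod_4_parity mod_4_diff_1[of _ 2, simplified])
  have m: "odd (?e m) \<or> m \<in> {k, l}"
    using three(9) by (auto simp: mod_4_parity mod_4_diff_1[of _ 2, simplified])
  show ?thesis
    using i j m three(1-6)
      share_bit_mod_4I[of i I j ?e] share_bit_oddI[of i I j ?e]
      share_bit_oddI[of i I m ?e] share_bit_oddI[of j I m ?e]
    by blast
next
  case four
  then obtain i j where "i \<in> I - {k, l}" "j \<in> I - {k, l}" "i \<noteq> j" "odd (a i)" "odd (a j)"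
    by (rule two_more_odd)
  then show ?thesis using share_bit_oddI[of i I j ?e] by auto
qed

subsection \<open>Even summands\<close>

text \<open>Parity is tracked inside the complex numbers, where \<open>y_val\<close> lives. Closure
  under sums and under natural multiples is enough to assemble it from its summands.\<close>

definition even_Nats :: "complex set" where
  "even_Nats = range (\<lambda>q::nat. 2 * of_nat q)"

lemma even_NatsI: "2 * of_nat q \<in> even_Nats"
  by (simp add: even_Nats_def)

lemma even_NatsE:
  assumes "c \<in> even_Nats"
  obtains q :: nat where "c = 2 * of_nat q"
  using assms by (auto simp: even_Nats_def)

lemma zero_in_even_Nats: "0 \<in> even_Nats"
  using even_NatsI[of 0] by simp

lemma even_Nats_add:
  assumes "c \<in> even_Nats" "d \<in> even_Nats"
  shows "c + d \<in> even_Nats"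
proof -
  obtain p q :: nat where "c = 2 * of_nat p" "d = 2 * of_nat q"
    using assms by (auto elim!: even_NatsE)
  then show ?thesis using even_NatsI[of "p + q"] by (simp add: algebra_simps)
qed

lemma even_Nats_sum: "(\<And>i. i \<in> A \<Longrightarrow> f i \<in> even_Nats) \<Longrightarrow> sum f A \<in> even_Nats"
  by (induction A rule: infinite_finite_induct) (auto simp: zero_in_even_Nats even_Nats_add)

lemma even_Nats_mult:
  assumes "c \<in> \<nat>" "d \<in> even_Nats"
  shows "c * d \<in> even_Nats"
proof -
  obtain p q :: nat where "c = of_nat p" "d = 2 * of_nat q"
    using assms by (auto elim!: even_NatsE Nats_cases)
  then show ?thesis using even_NatsI[of "p * q"] by (simp add: algebra_simps)
qed

lemma multinomial_in_even_Nats: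
  assumes "finite I" "share_bit I e"
  shows "fact (\<Sum>k\<in>I. e k) / (\<Prod>k\<in>I. fact (e k)) \<in> even_Nats"
proof -
  obtain q :: nat where q: "fact (\<Sum>k\<in>I. e k) = 2 * (\<Prod>k\<in>I. fact (e k)) * q"
    using multinomial_even[OF assms] by blast
  have "fact (\<Sum>k\<in>I. e k) = (of_nat (fact (\<Sum>k\<in>I. e k)) :: complex)" by (simp only: of_nat_fact)
  also have "\<dots> = 2 * of_nat q * (\<Prod>k\<in>I. fact (e k))"
    unfolding q by simp
  finally show ?thesis using even_NatsI[of q] assms(1) by simp
qed

section \<open>The summands of \<open>y_val\<close> as multinomial coefficients\<close>

lemma prod_fact_decrement:
  fixes a :: "'i \<Rightarrow> nat"
  assumes "finite I" "i \<in> I" "a i > 0"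
  shows "(\<Prod>k\<in>I. fact (a k)) = of_nat (a i) * (\<Prod>k\<in>I. fact ((a(i := a i - 1)) k) :: 'b :: {comm_semiring_1, semiring_char_0})"
proof -
  have "(\<Prod>k\<in>I - {i}. fact ((a(i := a i - 1)) k) :: 'b) = (\<Prod>k\<in>I - {i}. fact (a k))"
    by (rule prod.cong) auto
  then show ?thesis
    using assms by (simp add: prod.remove[of I i] fact_reduce[of "a i"] mult.assoc)
qed

lemma sum_decrement:
  fixes a :: "'i \<Rightarrow> nat"
  assumes "finite I" "i \<in> I" "a i \<ge> c"
  shows "(\<Sum>k\<in>I. (a(i := a i - c)) k) = (\<Sum>k\<in>I. a k) - c"
proof -
  have "(\<Sum>k\<in>I - {i}. (a(i := a i - c)) k) = (\<Sum>k\<in>I - {i}. a k)"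
    by (rule sum.cong) auto
  then show ?thesis using assms by (simp add: sum.remove[of I i])
qed

text \<open>The factors \<open>a i\<close> and \<open>a j\<close> cancel against the factorials,
  leaving the multinomial coefficient with these two entries lowered by 1. If one of them is 0, the
  whole term vanishes.\<close>

lemma off_diagonal_term_in_even_Nats:
  assumes "size_cond I a" "finite I" "i \<in> I" "j \<in> I" "i \<noteq> j"
  shows "fact ((\<Sum>k\<in>I. a k) - 2) / (\<Prod>k\<in>I. fact (a k)) * of_nat (a i * a j) \<in> even_Nats"
proof (cases "a i = 0 \<or> a j = 0")
  case True
  then show ?thesis using zero_in_even_Nats by auto
next
  case False
  define b where "b = a(i := a i - 1)"
  define e where "e = b(j := b j - 1)"
  have bj: "b j = a j" using assms(5) by (simp add: b_def)
  have "(\<Prod>k\<in>I. fact (a k)) = of_nat (a i * a j) * (\<Prod>k\<in>I. fact (e k) :: complex)"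
    using prod_fact_decrement[of I i a, folded b_def, where 'b = complex]
      prod_fact_decrement[of I j b, folded e_def, where 'b = complex]
      assms False bj by (simp add: mult.assoc)
  moreover have "(\<Sum>k\<in>I. e k) = (\<Sum>k\<in>I. a k) - 2"
    using sum_decrement[of I i 1 a, folded b_def] sum_decrement[of I j 1 b, folded e_def]
      assms False bj by simp
  moreover have "share_bit I e"
    using share_bit_diff_1_1[OF assms(1,5)] False bj by (simp add: e_def b_def)
  ultimately show ?thesis
    using multinomial_in_even_Nats[of I e] assms(2) False by (simp add: field_simps)
qed

text \<open>For \<open>a k < 2\<close> a lower entry is negative and the value is 0 by convention;
  otherwise this is the coefficient with \<open>a k\<close> lowered by 2.\<close>

lemma diagonal_multinom_in_even_Nats:
  assumes "size_cond I a" "finite I" "k \<in> I"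
  shows "multinom ((\<Sum>l\<in>I. a l) - 2) I (\<lambda>l. if l = k then int (a l) - 2 else int (a l)) \<in> even_Nats"
proof (cases "a k \<ge> 2")
  case True
  let ?e = "a(k := a k - 2)"
  \<comment> \<open>\<open>nat\<close> truncates at 0 exactly as subtraction of natural numbers
    does.\<close>
  have "nat (if l = k then int (a l) - 2 else int (a l)) = ?e l" for l
    by (simp, arith)
  then have "multinom ((\<Sum>l\<in>I. a l) - 2) I (\<lambda>l. if l = k then int (a l) - 2 else int (a l))
      = fact ((\<Sum>l\<in>I. a l) - 2) / (\<Prod>l\<in>I. fact (?e l))"
    unfolding multinom_def using True by (auto simp only: split: if_splits)
  moreover have "(\<Sum>l\<in>I. ?e l) = (\<Sum>l\<in>I. a l) - 2"
    using assms True by (intro sum_decrement)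
  ultimately show ?thesis
    using multinomial_in_even_Nats[OF assms(2) share_bit_diff_2[OF assms(1) True]] by metis
next
  case False
  then show ?thesis using assms(3) zero_in_even_Nats by (auto simp: multinom_def)
qed

theorem theorem6:
  fixes n r :: nat and lam :: "nat \<Rightarrow> nat list" and a :: "nat \<Rightarrow> nat"
  assumes "n > 0" and "r > 0"
    and "\<And>k. k \<in> {1..r} \<Longrightarrow> is_partition_of (lam k) (a k)"
    and "(\<Sum>k=1..r. a k) = n"
    and "(\<exists>i\<in>{1..r}. \<exists>j\<in>{1..r}. i \<noteq> j \<and>
            (bin (a i) - {ord2 (a i)}) \<inter> (bin (a j) - {ord2 (a j)}) \<noteq> {})
       \<or> (\<exists>i\<in>{1..r}. \<exists>j\<in>{1..r}. \<exists>k\<in>{1..r}. i \<noteq> j \<and> i \<noteq> k \<and> j \<noteq> k \<and>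
            a i mod 4 = 2 \<and> a j mod 4 = 2 \<and> a k mod 4 = 2)
       \<or> (\<exists>i\<in>{1..r}. \<exists>j\<in>{1..r}. \<exists>k\<in>{1..r}.
            a i mod 4 = 3 \<and> a j mod 4 = 2 \<and> a k mod 4 = 1)
       \<or> card {k \<in> {1..r}. odd (a k)} \<ge> 4"
  shows "\<exists>z::int. y_val r lam = of_int z \<and> even z"
proof -
  let ?I = "{1..r}"
  define f where "f = (\<lambda>k. irr_dim (lam k))"
  define g where "g = (\<lambda>k. g_coeff (lam k))"
  have size: "size_cond ?I a" using assms(5) unfolding size_cond_def .
  have a: "sum_list (lam k) = a k" if "k \<in> ?I" for k
    using assms(3)[OF that] by (simp add: is_partition_of_def)
  have "y_val r lam =
      (\<Prod>k\<in>?I. of_nat (f k)) * (fact ((\<Sum>k\<in>?I. a k) - 2) / (\<Prod>k\<in>?I. fact (a k)))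
        * (\<Sum>(i, j)\<in>{(i, j). 1 \<le> i \<and> i < j \<and> j \<le> r}. of_nat (a i * a j))
      + (\<Sum>k\<in>?I. g k * (\<Prod>j\<in>?I - {k}. of_nat (f j))
        * multinom ((\<Sum>k\<in>?I. a k) - 2) ?I (\<lambda>l. if l = k then int (a l) - 2 else int (a l)))"
  proof -
    have "(\<Sum>(i, j)\<in>{(i, j). 1 \<le> i \<and> i < j \<and> j \<le> r}. of_nat (sum_list (lam i) * sum_list (lam j)))
        = (\<Sum>(i, j)\<in>{(i, j). 1 \<le> i \<and> i < j \<and> j \<le> r}. of_nat (a i * a j) :: complex)"
      by (rule sum.cong) (auto simp: a)
    moreover have "multinom N ?I (\<lambda>l. if l = k then int (sum_list (lam l)) - 2 else int (sum_list (lam l)))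
        = multinom N ?I (\<lambda>l. if l = k then int (a l) - 2 else int (a l))" for N k
      by (simp add: multinom_def a cong: if_cong)
    ultimately show ?thesis
      by (simp add: y_val_def Let_def a f_def g_def)
  qed
  \<comment> \<open>Moving the quotient of factorials into the sum makes each pair contribute a
    single multinomial coefficient.\<close>
  also have "\<dots> = (\<Prod>k\<in>?I. of_nat (f k)) * (\<Sum>(i, j)\<in>{(i, j). 1 \<le> i \<and> i < j \<and> j \<le> r}.
        fact ((\<Sum>k\<in>?I. a k) - 2) / (\<Prod>k\<in>?I. fact (a k)) * of_nat (a i * a j))
      + (\<Sum>k\<in>?I. g k * (\<Prod>j\<in>?I - {k}. of_nat (f j))
        * multinom ((\<Sum>k\<in>?I. a k) - 2) ?I (\<lambda>l. if l = k then int (a l) - 2 else int (a l)))"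
    by (simp add: sum_distrib_left case_prod_unfold mult.assoc)
  also have "\<dots> \<in> even_Nats"
  \<comment> \<open>The dimensions and the values of \<open>g\<close> are natural numbers, so only
    the multinomial factors have to be even.\<close>
  proof (intro even_Nats_add even_Nats_sum even_Nats_mult Nats_mult)
    fix p assume "p \<in> {(i, j). 1 \<le> i \<and> i < j \<and> j \<le> r}"
    then show "(case p of (i, j) \<Rightarrow> fact ((\<Sum>k\<in>?I. a k) - 2) / (\<Prod>k\<in>?I. fact (a k)) * of_nat (a i * a j))
        \<in> even_Nats"
      using off_diagonal_term_in_even_Nats[OF size, of "fst p" "snd p"]
      by (auto simp: case_prod_unfold simp del: of_nat_mult)
  qed (use size in \<open>auto simp: g_def g_coeff_in_Nats of_nat_prod[symmetric]
      simp del: of_nat_prod intro: diagonal_multinom_in_even_Nats\<close>)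
  finally obtain q :: nat where "y_val r lam = 2 * of_nat q" by (rule even_NatsE)
  then show ?thesis by (intro exI[of _ "2 * int q"]) simp
qed

end
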